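(* Let $X$ be a nonempty set, $Y$ a nonempty subset of $X$, and $f,g\in\overline{\Omega}(X,Y)$. Then $(f,g)\in\mathcal{D}$ in $\overline{\Omega}(X,Y)$ if and only if both of the following hold: (i) $|Xf\setminus Y|=|Xg\setminus Y|$; (ii) there exists $\alpha\in S(Y)$ such that $|y(f_{\upharpoonright Y})^{-1}|=|(y\alpha)(g_{\upharpoonright Y})^{-1}|$ for all $y\in Y$.
   Context: $T(X)$ is the semigroup of all maps $X\to X$ under composition; maps are written on the right and composed from left to right, so $x(fg)=(xf)g$, and for $B\subseteq X$, $Bf=\{xf\colon x\in B\}$. Let $\overline{\Omega}(X,Y)=\{f\in T(X)\colon Yf=Y\}$, a subsemigroup of $T(X)$ containing the identity map. For $f\in\overline{\Omega}(X,Y)$, $f_{\upharpoonright Y}\colon Y\to Y$ denotes the (surjective) map that agrees with $f$ on $Y$, and for $y\in Y$, $y(f_{\upharpoonright Y})^{-1}=\{z\in Y\colon zf=y\}$. $S(Y)$ is the symmetric group on $Y$ (all bijections $Y\to Y$). $|A|$ denotes the cardinality of $A$. Green's relations on a semigroup $S$ with identity: $(a,b)\in\mathcal{L}$ iff $a=cb$ and $b=da$ for some $c,d\in S$; $(a,b)\in\mathcal{R}$ iff $a=bc$ and $b=ad$ for some $c,d\in S$; $\mathcal{D}=\mathcal{L}\circ\mathcal{R}$. *)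

theory Defs
  imports "HOL-Algebra.Bij" "HOL-Library.Equipollence"
begin

section \<open>Green's relations\<close>

text \<open>Only meant for structures with an identity; this is why no identity is adjoined.\<close>

definition green_L :: "('a, 'm) monoid_scheme \<Rightarrow> 'a rel"
  where "green_L S = {(a, b). a \<in> carrier S \<and> b \<in> carrier S \<and>
    (\<exists>c\<in>carrier S. \<exists>d\<in>carrier S. a = c \<otimes>\<^bsub>S\<^esub> b \<and> b = d \<otimes>\<^bsub>S\<^esub> a)}"

definition green_R :: "('a, 'm) monoid_scheme \<Rightarrow> 'a rel"
  where "green_R S = {(a, b). a \<in> carrier S \<and> b \<in> carrier S \<and>
    (\<exists>c\<in>carrier S. \<exists>d\<in>carrier S. a = b \<otimes>\<^bsub>S\<^esub> c \<and> b = a \<otimes>\<^bsub>S\<^esub> d)}"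

definition green_D :: "('a, 'm) monoid_scheme \<Rightarrow> 'a rel"
  where "green_D S = green_L S O green_R S"


section \<open>Transformation semigroups\<close>

text \<open>Maps \<open>X \<rightarrow> X\<close> are extensional functions. They act on the right and are composed
  from left to right, hence the product of \<open>f\<close> and \<open>g\<close> is \<open>x \<mapsto> g (f x)\<close>.\<close>

definition full_transf :: "'a set \<Rightarrow> ('a \<Rightarrow> 'a) monoid"
  where "full_transf X =
    \<lparr>carrier = X \<rightarrow>\<^sub>E X, mult = (\<lambda>f g. compose X g f), one = (\<lambda>x\<in>X. x)\<rparr>"

definition Omega_bar :: "'a set \<Rightarrow> 'a set \<Rightarrow> ('a \<Rightarrow> 'a) monoid"
  where "Omega_bar X Y =
    (full_transf X)\<lparr>carrier := {f \<in> carrier (full_transf X). f ` Y = Y}\<rparr>"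

lemma monoid_full_transf: "monoid (full_transf X)"
  by (rule monoidI)
    (auto simp: full_transf_def compose_def fun_eq_iff PiE_iff extensional_def)

lemma submonoid_Omega_bar:
  assumes "Y \<subseteq> X"
  shows "submonoid (carrier (Omega_bar X Y)) (full_transf X)"
proof
  show "carrier (Omega_bar X Y) \<subseteq> carrier (full_transf X)"
    by (auto simp: Omega_bar_def)
  show "\<one>\<^bsub>full_transf X\<^esub> \<in> carrier (Omega_bar X Y)"
    using assms by (auto simp: Omega_bar_def full_transf_def image_iff subset_iff)
  fix f g
  assume f: "f \<in> carrier (Omega_bar X Y)" and g: "g \<in> carrier (Omega_bar X Y)"
  have "compose X g f ` Y = g ` f ` Y"
    using assms by (force simp: compose_def image_iff)
  with f g show "f \<otimes>\<^bsub>full_transf X\<^esub> g \<in> carrier (Omega_bar X Y)"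
    by (auto simp: Omega_bar_def full_transf_def compose_def PiE_iff)
qed

lemma monoid_Omega_bar: "Y \<subseteq> X \<Longrightarrow> monoid (Omega_bar X Y)"
  using submonoid.submonoid_is_monoid[OF submonoid_Omega_bar monoid_full_transf]
  by (simp add: Omega_bar_def)

end

theory Submission imports Defs
begin

text \<open>
  In this monoid \<open>\<L>\<close> and \<open>\<R>\<close> have concrete descriptions. Left factors rearrange arguments:
  \<open>f \<L> g\<close> holds iff \<open>f\<close> and \<open>g\<close> have the same image and equipollent fibres inside \<open>Y\<close> over
  each point of \<open>Y\<close> (\<open>green_L_Omega_bar_iff\<close>). Right factors relabel values: \<open>f \<R> g\<close> holds
  iff \<open>g\<close> arises from \<open>f\<close> by a bijection between the images that carries \<open>Y\<close> onto \<open>Y\<close>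
  (\<open>green_R_Omega_bar_iff\<close>).

  Hence \<open>f \<D> g\<close> holds iff \<open>g\<close> can be relabelled so that its image becomes \<open>f ` X\<close> and its fibres
  inside \<open>Y\<close> match those of \<open>f\<close> (\<open>green_D_Omega_bar_iff\<close>). As \<open>Y\<close> is contained in both images, a
  bijection between \<open>g ` X\<close> and \<open>f ` X\<close> that carries \<open>Y\<close> onto \<open>Y\<close> consists of
  two independent parts: a permutation of \<open>Y\<close>, which has to match the fibres, and a bijection
  between \<open>g ` X - Y\<close> and \<open>f ` X - Y\<close>, which is subject to no further condition.
\<close>

lemma carrier_Omega_bar_iff:
  "f \<in> carrier (Omega_bar X Y) \<longleftrightarrow> f \<in> X \<rightarrow>\<^sub>E X \<and> f ` Y = Y"
  by (auto simp: Omega_bar_def full_transf_def)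

lemma subset_image_Omega_bar:
  assumes "Y \<subseteq> X" "f \<in> carrier (Omega_bar X Y)"
  shows "Y \<subseteq> f ` X"
proof -
  have "Y = f ` Y"
    using assms(2) by (simp add: carrier_Omega_bar_iff)
  also have "\<dots> \<subseteq> f ` X"
    using assms(1) by (rule image_mono)
  finally show ?thesis .
qed

lemma restrict_in_carrier_Omega_bar:
  assumes "Y \<subseteq> X" and "\<And>x. x \<in> X \<Longrightarrow> c x \<in> X" and "c ` Y = Y"
  shows "restrict c X \<in> carrier (Omega_bar X Y)"
proof -
  have "restrict c X ` Y = c ` Y"
    using assms(1) by (intro image_cong) auto
  with assms show ?thesis
    by (auto simp: carrier_Omega_bar_iff)
qed

lemma eq_mult_Omega_bar_iff:
  assumes "h \<in> carrier (Omega_bar X Y)"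
  shows "h = f \<otimes>\<^bsub>Omega_bar X Y\<^esub> g \<longleftrightarrow> (\<forall>x\<in>X. h x = g (f x))"
proof -
  have "h \<in> extensional X"
    using assms by (auto simp: carrier_Omega_bar_iff PiE_def)
  then show ?thesis
    by (auto simp: Omega_bar_def full_transf_def compose_def fun_eq_iff extensional_def)
qed


section \<open>Green's relation \<open>\<L>\<close>\<close>

text \<open>A left factor \<open>c\<close> of \<open>f = c g\<close> sends the fibre of \<open>f\<close> into the fibre of \<open>g\<close>, and it does so
  surjectively because \<open>Y\<close> is all of \<open>c ` Y\<close>; a surjection bounds the cardinality of its range.\<close>

lemma fibre_lepoll_of_left_factor:
  assumes "c ` Y = Y" and "\<And>z. z \<in> Y \<Longrightarrow> f z = g (c z)"
  shows "{z \<in> Y. g z = y} \<lesssim> {z \<in> Y. f z = y}"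
proof -
  have "{z \<in> Y. g z = y} \<subseteq> c ` {z \<in> Y. f z = y}"
  proof
    fix z assume z: "z \<in> {z \<in> Y. g z = y}"
    then obtain w where "w \<in> Y" "z = c w"
      using assms(1) by blast
    with z assms(2) show "z \<in> c ` {z \<in> Y. f z = y}"
      by auto
  qed
  then show ?thesis
    using image_lepoll subset_imp_lepoll lepoll_trans by blast
qed

text \<open>Conversely, bijections between the fibres over the points of \<open>Y\<close> glue to a left factor on
  \<open>Y\<close>, which is onto \<open>Y\<close> because the fibres of \<open>g\<close> cover \<open>Y\<close>; a point outside \<open>Y\<close> may be sent to
  any preimage of its value.\<close>

lemma left_factor_of_eqpoll_fibres:
  assumes "Y \<subseteq> X" "f ` Y = Y" "g ` Y = Y" "f ` X \<subseteq> g ` X"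
    and fib: "\<And>y. y \<in> Y \<Longrightarrow> {z \<in> Y. f z = y} \<approx> {z \<in> Y. g z = y}"
  shows "\<exists>c\<in>carrier (Omega_bar X Y). \<forall>x\<in>X. f x = g (c x)"
proof -
  have "\<exists>b. bij_betw b {z \<in> Y. f z = y} {z \<in> Y. g z = y}" if "y \<in> Y" for y
    using fib[OF that] by (simp add: eqpoll_def)
  then obtain b where b: "\<And>y. y \<in> Y \<Longrightarrow> bij_betw (b y) {z \<in> Y. f z = y} {z \<in> Y. g z = y}"
    by metis
  define c where "c x = (if x \<in> Y then b (f x) x else inv_into X g (f x))" for x
  have cY: "c x \<in> Y \<and> g (c x) = f x" if "x \<in> Y" for x
    using b[of "f x"] that assms(2) bij_betwE by (fastforce simp: c_def)
  have cX: "c x \<in> X \<and> g (c x) = f x" if "x \<in> X" for x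
  proof (cases "x \<in> Y")
    case True
    then show ?thesis using cY assms(1) by auto
  next
    case False
    have "f x \<in> g ` X"
      using that assms(4) by auto
    then show ?thesis
      using False by (simp add: c_def inv_into_into f_inv_into_f)
  qed
  have "Y \<subseteq> c ` Y"
  proof
    fix z assume z: "z \<in> Y"
    then have "g z \<in> Y"
      using assms(3) by auto
    from bij_betw_imp_surj_on[OF b[OF this]] z
    obtain w where "w \<in> Y" "f w = g z" "z = b (g z) w"
      by fastforce
    then show "z \<in> c ` Y"
      by (auto simp: c_def image_iff intro!: bexI[of _ w])
  qed
  then have "restrict c X \<in> carrier (Omega_bar X Y)"
    using cX cY assms(1) by (intro restrict_in_carrier_Omega_bar) auto
  then show ?thesis
    using cX by (intro bexI[of _ "restrict c X"]) simp_all
qed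

lemma green_L_Omega_bar_factors:
  assumes f: "f \<in> carrier (Omega_bar X Y)" and g: "g \<in> carrier (Omega_bar X Y)"
  shows "(f, g) \<in> green_L (Omega_bar X Y) \<longleftrightarrow>
    (\<exists>c\<in>carrier (Omega_bar X Y). \<exists>d\<in>carrier (Omega_bar X Y).
      (\<forall>x\<in>X. f x = g (c x)) \<and> (\<forall>x\<in>X. g x = f (d x)))"
  unfolding green_L_def mem_Collect_eq prod.case eq_mult_Omega_bar_iff[OF f]
    eq_mult_Omega_bar_iff[OF g] using f g by blast

lemma green_L_Omega_bar_iff:
  assumes "Y \<subseteq> X" and f: "f \<in> carrier (Omega_bar X Y)" and g: "g \<in> carrier (Omega_bar X Y)"
  shows "(f, g) \<in> green_L (Omega_bar X Y) \<longleftrightarrow>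
    f ` X = g ` X \<and> (\<forall>y\<in>Y. {z \<in> Y. f z = y} \<approx> {z \<in> Y. g z = y})" (is "_ \<longleftrightarrow> ?im \<and> ?fib")
proof
  assume "(f, g) \<in> green_L (Omega_bar X Y)"
  then obtain c d where c: "c \<in> carrier (Omega_bar X Y)" "\<And>x. x \<in> X \<Longrightarrow> f x = g (c x)"
    and d: "d \<in> carrier (Omega_bar X Y)" "\<And>x. x \<in> X \<Longrightarrow> g x = f (d x)"
    unfolding green_L_Omega_bar_factors[OF f g] by blast
  have "c ` X \<subseteq> X" "d ` X \<subseteq> X" and cd: "c ` Y = Y" "d ` Y = Y"
    using c(1) d(1) by (auto simp: carrier_Omega_bar_iff)
  moreover have "f ` X = g ` c ` X"
    unfolding image_image by (rule image_cong[OF refl c(2)])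
  moreover have "g ` X = f ` d ` X"
    unfolding image_image by (rule image_cong[OF refl d(2)])
  ultimately have ?im
    by (metis image_mono subset_antisym)
  moreover have ?fib
  proof
    fix y assume "y \<in> Y"
    show "{z \<in> Y. f z = y} \<approx> {z \<in> Y. g z = y}"
    proof (rule lepoll_antisym)
      show "{z \<in> Y. f z = y} \<lesssim> {z \<in> Y. g z = y}"
        using cd(2) by (rule fibre_lepoll_of_left_factor) (rule d(2)[OF subsetD[OF assms(1)]])
      show "{z \<in> Y. g z = y} \<lesssim> {z \<in> Y. f z = y}"
        using cd(1) by (rule fibre_lepoll_of_left_factor) (rule c(2)[OF subsetD[OF assms(1)]])
    qed
  qed
  ultimately show "?im \<and> ?fib" ..
next
  assume R: "?im \<and> ?fib"
  have Y: "f ` Y = Y" "g ` Y = Y"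
    using f g by (auto simp: carrier_Omega_bar_iff)
  have "\<exists>c\<in>carrier (Omega_bar X Y). \<forall>x\<in>X. f x = g (c x)"
    by (rule left_factor_of_eqpoll_fibres[OF assms(1) Y]) (simp_all add: R)
  moreover have "\<exists>d\<in>carrier (Omega_bar X Y). \<forall>x\<in>X. g x = f (d x)"
    by (rule left_factor_of_eqpoll_fibres[OF assms(1) Y(2,1)]) (simp_all add: R eqpoll_sym)
  ultimately show "(f, g) \<in> green_L (Omega_bar X Y)"
    unfolding green_L_Omega_bar_factors[OF f g] by blast
qed


section \<open>Green's relation \<open>\<R>\<close>\<close>

text \<open>A relabelling \<open>c\<close> is meaningful only on the image \<open>A\<close> of the map whose values it relabels.
  Letting it fix the other points of \<open>X\<close> makes it an element of the monoid.\<close>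

lemma right_factor_of_map_on_image:
  assumes "Y \<subseteq> A" "A \<subseteq> X" "c ` A \<subseteq> X" "c ` Y = Y"
  obtains c' where "c' \<in> carrier (Omega_bar X Y)" "\<And>x. x \<in> A \<Longrightarrow> c' x = c x"
proof -
  define c' where "c' = restrict (\<lambda>x. if x \<in> A then c x else x) X"
  have "(\<lambda>x. if x \<in> A then c x else x) ` Y = c ` Y"
    using assms(1) by (intro image_cong) auto
  then have "c' \<in> carrier (Omega_bar X Y)"
    unfolding c'_def using assms by (intro restrict_in_carrier_Omega_bar) auto
  then show thesis
    using that[of c'] assms(2) by (simp add: c'_def subset_iff)
qed

lemma green_R_Omega_bar_factors:
  assumes f: "f \<in> carrier (Omega_bar X Y)" and g: "g \<in> carrier (Omega_bar X Y)"
  shows "(f, g) \<in> green_R (Omega_bar X Y) \<longleftrightarrow>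
    (\<exists>c\<in>carrier (Omega_bar X Y). \<exists>d\<in>carrier (Omega_bar X Y).
      (\<forall>x\<in>X. f x = c (g x)) \<and> (\<forall>x\<in>X. g x = d (f x)))"
  unfolding green_R_def mem_Collect_eq prod.case eq_mult_Omega_bar_iff[OF f]
    eq_mult_Omega_bar_iff[OF g] using f g by blast

text \<open>Mutual right factors are mutually inverse on the images, which contain \<open>Y\<close>.\<close>

lemma green_R_Omega_bar_iff:
  assumes "Y \<subseteq> X" and f: "f \<in> carrier (Omega_bar X Y)" and g: "g \<in> carrier (Omega_bar X Y)"
  shows "(f, g) \<in> green_R (Omega_bar X Y) \<longleftrightarrow>
    (\<exists>\<gamma>. bij_betw \<gamma> (f ` X) (g ` X) \<and> \<gamma> ` Y = Y \<and> (\<forall>x\<in>X. g x = \<gamma> (f x)))"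
proof
  assume "(f, g) \<in> green_R (Omega_bar X Y)"
  then obtain c d where c: "\<And>x. x \<in> X \<Longrightarrow> f x = c (g x)"
    and d: "d \<in> carrier (Omega_bar X Y)" "\<And>x. x \<in> X \<Longrightarrow> g x = d (f x)"
    unfolding green_R_Omega_bar_factors[OF f g] by blast
  have "bij_betw d (f ` X) (g ` X)"
    by (rule bij_betw_byWitness[where f' = c]) (auto simp flip: c d(2))
  then show "\<exists>\<gamma>. bij_betw \<gamma> (f ` X) (g ` X) \<and> \<gamma> ` Y = Y \<and> (\<forall>x\<in>X. g x = \<gamma> (f x))"
    using d by (auto simp: carrier_Omega_bar_iff)
next
  assume "\<exists>\<gamma>. bij_betw \<gamma> (f ` X) (g ` X) \<and> \<gamma> ` Y = Y \<and> (\<forall>x\<in>X. g x = \<gamma> (f x))"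
  then obtain \<gamma> where \<gamma>: "bij_betw \<gamma> (f ` X) (g ` X)" "\<gamma> ` Y = Y" "\<And>x. x \<in> X \<Longrightarrow> g x = \<gamma> (f x)"
    by blast
  have fg: "f ` X \<subseteq> X" "g ` X \<subseteq> X"
    using f g by (auto simp: carrier_Omega_bar_iff)
  have Y: "Y \<subseteq> f ` X" "Y \<subseteq> g ` X"
    using subset_image_Omega_bar[OF assms(1)] f g by simp_all
  define \<delta> where "\<delta> = inv_into (f ` X) \<gamma>"
  have inj: "inj_on \<gamma> (f ` X)"
    using \<gamma>(1) by (rule bij_betw_imp_inj_on)
  have "\<delta> ` g ` X = f ` X"
    unfolding \<delta>_def using \<gamma>(1) bij_betw_imp_surj_on bij_betw_inv_into by blast
  moreover have "\<delta> ` Y = Y"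
    unfolding \<delta>_def using inv_into_image_cancel[OF inj Y(1)] \<gamma>(2) by simp
  ultimately obtain c where c: "c \<in> carrier (Omega_bar X Y)" "\<And>x. x \<in> g ` X \<Longrightarrow> c x = \<delta> x"
    using right_factor_of_map_on_image[OF Y(2) fg(2), of \<delta>] fg(1) by metis
  have "\<gamma> ` f ` X \<subseteq> X"
    using \<gamma>(1) fg(2) by (simp add: bij_betw_imp_surj_on)
  then obtain d where d: "d \<in> carrier (Omega_bar X Y)" "\<And>x. x \<in> f ` X \<Longrightarrow> d x = \<gamma> x"
    using right_factor_of_map_on_image[OF Y(1) fg(1), of \<gamma>] \<gamma>(2) by blast
  have "f x = c (g x)" if "x \<in> X" for x
    using that c(2) \<gamma>(3) inv_into_f_f[OF inj] by (simp add: \<delta>_def)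
  moreover have "g x = d (f x)" if "x \<in> X" for x
    using that d(2) \<gamma>(3) by simp
  ultimately show "(f, g) \<in> green_R (Omega_bar X Y)"
    unfolding green_R_Omega_bar_factors[OF f g] using c(1) d(1) by blast
qed


section \<open>Green's relation \<open>\<D>\<close>\<close>

text \<open>The element linking \<open>f \<L> h\<close> with \<open>h \<R> g\<close> is determined by the relabelling: \<open>h\<close> is \<open>g\<close> followed
  by the inverse of \<open>\<gamma>\<close>, so the fibre of \<open>h\<close> over \<open>y\<close> is the fibre of \<open>g\<close> over \<open>\<gamma> y\<close>.\<close>

lemma green_D_Omega_bar_iff:
  assumes "Y \<subseteq> X" and f: "f \<in> carrier (Omega_bar X Y)" and g: "g \<in> carrier (Omega_bar X Y)"
  shows "(f, g) \<in> green_D (Omega_bar X Y) \<longleftrightarrow>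
    (\<exists>\<gamma>. bij_betw \<gamma> (f ` X) (g ` X) \<and> \<gamma> ` Y = Y \<and>
      (\<forall>y\<in>Y. {z \<in> Y. f z = y} \<approx> {z \<in> Y. g z = \<gamma> y}))" (is "_ \<longleftrightarrow> Ex ?P")
proof
  assume "(f, g) \<in> green_D (Omega_bar X Y)"
  then obtain h where L: "(f, h) \<in> green_L (Omega_bar X Y)" and R: "(h, g) \<in> green_R (Omega_bar X Y)"
    unfolding green_D_def by blast
  then have h: "h \<in> carrier (Omega_bar X Y)"
    unfolding green_L_def by blast
  from R obtain \<gamma> where \<gamma>: "bij_betw \<gamma> (h ` X) (g ` X)" "\<gamma> ` Y = Y" "\<And>x. x \<in> X \<Longrightarrow> g x = \<gamma> (h x)"
    unfolding green_R_Omega_bar_iff[OF assms(1) h g] by blast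
  have L: "f ` X = h ` X" "\<And>y. y \<in> Y \<Longrightarrow> {z \<in> Y. f z = y} \<approx> {z \<in> Y. h z = y}"
    using L unfolding green_L_Omega_bar_iff[OF assms(1) f h] by blast+
  have "{z \<in> Y. h z = y} = {z \<in> Y. g z = \<gamma> y}" if "y \<in> Y" for y
  proof -
    have "y \<in> h ` X"
      using subset_image_Omega_bar[OF assms(1) h] that by (rule subsetD)
    then have "\<gamma> (h z) = \<gamma> y \<longleftrightarrow> h z = y" if "z \<in> X" for z
      using that bij_betw_imp_inj_on[OF \<gamma>(1)] by (metis imageI inj_onD)
    then show ?thesis
      using \<gamma>(3) assms(1) by auto
  qed
  then have "?P \<gamma>"
    using \<gamma>(1,2) L by auto
  then show "\<exists>\<gamma>. ?P \<gamma>"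
    by (rule exI[where P = ?P])
next
  assume "\<exists>\<gamma>. ?P \<gamma>"
  then obtain \<gamma> where \<gamma>: "bij_betw \<gamma> (f ` X) (g ` X)" "\<gamma> ` Y = Y"
    and fib: "\<And>y. y \<in> Y \<Longrightarrow> {z \<in> Y. f z = y} \<approx> {z \<in> Y. g z = \<gamma> y}"
    by blast
  define \<delta> where "\<delta> = inv_into (f ` X) \<gamma>"
  have inj: "inj_on \<gamma> (f ` X)"
    using \<gamma>(1) by (rule bij_betw_imp_inj_on)
  have fX: "f ` X \<subseteq> X" and gY: "g ` Y = Y"
    using f g by (auto simp: carrier_Omega_bar_iff)
  have Y: "Y \<subseteq> f ` X"
    using assms(1) f by (rule subset_image_Omega_bar)
  have \<delta>im: "\<delta> ` g ` X = f ` X"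
    unfolding \<delta>_def using \<gamma>(1) bij_betw_imp_surj_on bij_betw_inv_into by blast
  have \<gamma>\<delta>: "\<gamma> (\<delta> (g x)) = g x" if "x \<in> X" for x
    unfolding \<delta>_def using that bij_betw_inv_into_right[OF \<gamma>(1)] by simp
  have \<delta>\<gamma>: "\<delta> (\<gamma> y) = y" if "y \<in> Y" for y
    unfolding \<delta>_def using that Y inv_into_f_f[OF inj] by blast
  define h where "h = restrict (\<lambda>x. \<delta> (g x)) X"
  have hX: "h ` X = f ` X"
    using \<delta>im by (auto simp: h_def image_image)
  have "(\<lambda>x. \<delta> (g x)) ` Y = \<delta> ` g ` Y"
    by (simp add: image_image)
  also have "\<dots> = Y"
    unfolding gY \<delta>_def using inv_into_image_cancel[OF inj Y] \<gamma>(2) by simp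
  finally have "(\<lambda>x. \<delta> (g x)) ` Y = Y" .
  moreover have "\<delta> (g x) \<in> X" if "x \<in> X" for x
    using that \<delta>im fX by blast
  ultimately have h: "h \<in> carrier (Omega_bar X Y)"
    unfolding h_def using assms(1) by (intro restrict_in_carrier_Omega_bar)
  have "{z \<in> Y. h z = y} = {z \<in> Y. g z = \<gamma> y}" if "y \<in> Y" for y
    using that assms(1) \<gamma>\<delta> \<delta>\<gamma> by (fastforce simp: h_def)
  then have "(f, h) \<in> green_L (Omega_bar X Y)"
    unfolding green_L_Omega_bar_iff[OF assms(1) f h] using hX fib by simp
  moreover have "(h, g) \<in> green_R (Omega_bar X Y)"
    unfolding green_R_Omega_bar_iff[OF assms(1) h g] hX using \<gamma> \<gamma>\<delta> by (auto simp: h_def)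
  ultimately show "(f, g) \<in> green_D (Omega_bar X Y)"
    unfolding green_D_def by blast
qed

theorem theorem4p8:
  fixes X Y :: "'a set" and f g :: "'a \<Rightarrow> 'a"
  assumes "X \<noteq> {}"
    and "Y \<noteq> {}"
    and "Y \<subseteq> X"
    and "f \<in> carrier (Omega_bar X Y)"
    and "g \<in> carrier (Omega_bar X Y)"
  shows "(f, g) \<in> green_D (Omega_bar X Y) \<longleftrightarrow>
    (f ` X - Y) \<approx> (g ` X - Y) \<and>
    (\<exists>\<alpha>\<in>Bij Y. \<forall>y\<in>Y.
      {z \<in> Y. restrict f Y z = y} \<approx> {z \<in> Y. restrict g Y z = \<alpha> y})"
proof -
  have restr: "{z \<in> Y. restrict k Y z = w} = {z \<in> Y. k z = w}" for k :: "'a \<Rightarrow> 'a" and w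
    by auto
  have Y: "Y \<subseteq> f ` X" "Y \<subseteq> g ` X"
    using subset_image_Omega_bar[OF assms(3)] assms(4,5) by simp_all
  show ?thesis
    unfolding green_D_Omega_bar_iff[OF assms(3-5)] restr
  proof (intro iffI; (elim exE conjE bexE)?)
    fix \<gamma> assume \<gamma>: "bij_betw \<gamma> (f ` X) (g ` X)" "\<gamma> ` Y = Y"
      and fib: "\<forall>y\<in>Y. {z \<in> Y. f z = y} \<approx> {z \<in> Y. g z = \<gamma> y}"
    have inj: "inj_on \<gamma> (f ` X)"
      using \<gamma>(1) by (rule bij_betw_imp_inj_on)
    have "\<gamma> ` (f ` X - Y) = g ` X - Y"
      using inj_on_image_set_diff[OF inj _ Y(1)] \<gamma> by (auto simp: bij_betw_imp_surj_on)
    then have "bij_betw \<gamma> (f ` X - Y) (g ` X - Y)"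
      using inj by (auto simp: bij_betw_def intro: inj_on_subset)
    moreover have "bij_betw \<gamma> Y Y"
      using inj Y(1) \<gamma>(2) by (auto simp: bij_betw_def intro: inj_on_subset)
    then have "restrict \<gamma> Y \<in> Bij Y"
      by (simp add: Bij_def)
    ultimately show "f ` X - Y \<approx> g ` X - Y \<and>
        (\<exists>\<alpha>\<in>Bij Y. \<forall>y\<in>Y. {z \<in> Y. f z = y} \<approx> {z \<in> Y. g z = \<alpha> y})"
      using fib by (auto simp: eqpoll_def intro!: bexI[of _ "restrict \<gamma> Y"])
  next
    fix \<alpha> assume "f ` X - Y \<approx> g ` X - Y" and "\<alpha> \<in> Bij Y"
      and fib: "\<forall>y\<in>Y. {z \<in> Y. f z = y} \<approx> {z \<in> Y. g z = \<alpha> y}"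
    then obtain \<beta> where \<beta>: "bij_betw \<beta> (f ` X - Y) (g ` X - Y)" and \<alpha>: "bij_betw \<alpha> Y Y"
      by (auto simp: eqpoll_def Bij_def)
    define \<gamma> where "\<gamma> x = (if x \<in> Y then \<alpha> x else \<beta> x)" for x
    have \<gamma>Y: "bij_betw \<gamma> Y Y"
      using \<alpha> by (subst bij_betw_cong[where g = \<alpha>]) (auto simp: \<gamma>_def)
    have "bij_betw \<gamma> (f ` X - Y) (g ` X - Y)"
      using \<beta> by (subst bij_betw_cong[where g = \<beta>]) (auto simp: \<gamma>_def)
    with \<gamma>Y have "bij_betw \<gamma> (Y \<union> (f ` X - Y)) (Y \<union> (g ` X - Y))"
      by (rule bij_betw_combine) auto
    then have "bij_betw \<gamma> (f ` X) (g ` X)"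
      using Y by (simp add: Un_absorb1)
    moreover have "\<gamma> ` Y = Y"
      using \<gamma>Y by (rule bij_betw_imp_surj_on)
    ultimately show "\<exists>\<gamma>. bij_betw \<gamma> (f ` X) (g ` X) \<and> \<gamma> ` Y = Y \<and>
        (\<forall>y\<in>Y. {z \<in> Y. f z = y} \<approx> {z \<in> Y. g z = \<gamma> y})"
      using fib by (auto simp: \<gamma>_def intro!: exI[of _ \<gamma>])
  qed
qed

end
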